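(* Let $\pi\in\mathfrak{B}_n$. In the grid $P_\pi$: (a) each $0_h^+$-path (resp. $1_h^+$-path) goes from the left boundary to the right boundary along horizontal grid lines, except that it takes a southeast (resp. northeast) diagonal step across a positive square when it encounters one; (b) each $0_v^+$-path (resp. $1_v^+$-path) goes from the top boundary to the bottom boundary along vertical grid lines, except that it takes a southeast (resp. southwest) step across a positive square when it encounters one; (c) each $0_h^-$-path (resp. $1_h^-$-path) goes from the left boundary to the right boundary along horizontal grid lines, except that it takes a northeast (resp. southeast) step across a negative square when it encounters one; (d) each $0_v^-$-path (resp. $1_v^-$-path) goes from the top boundary to the bottom boundary along vertical grid lines, except that it takes a southwest (resp. southeast) step across a negative square when it encounters one.
   Context: $\mathfrak{B}_n$ is the set of signed permutations $\pi=\pi_1\cdots\pi_n$ ($\pi_i\in\{\pm1,\dots,\pm n\}$, $|\pi_1|,\dots,|\pi_n|$ a permutation of $[n]$), $\pi_0=0$, inverse given by $\pi^{-1}_{|\pi_i|}=\operatorname{sgn}(\pi_i)\,i$. Natural order: $\operatorname{des}^B(\pi)=|\{i\in\{0,\dots,n-1\}:\pi_i>\pi_{i+1}\}|$, $\operatorname{ides}^B(\pi)=\operatorname{des}^B(\pi^{-1})$. The grid $P_\pi$ is an $n\times n$ array of squares (rows from top, columns from left); $\langle i,j\rangle$ is the square in row $i$, column $j$; $\langle i,|\pi_i|\rangle$ is a positive square if $\pi_i>0$, negative if $\pi_i<0$. Grid point $(i,j)$ ($1\le i,j\le n+1$) is the intersection of the $i$-th horizontal and $j$-th vertical grid lines.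 For $i,j\in[n+1]$, $\varphi_{(i,j)}(\pi)$ is the $\sigma\in\mathfrak{B}_{n+1}$ with $\sigma_i=j$, $\sigma_k=s(\pi_k)$ for $k<i$, $\sigma_k=s(\pi_{k-1})$ for $k>i$, where $s(x)=x$ if $|x|<j$, $s(x)=x+1$ if $x\ge j$, $s(x)=x-1$ if $x\le-j$ (insertion of a positive square at grid point $(i,j)$); $\overline{\varphi}_{(i,j)}(\pi)$ is the same with $\sigma_i=-j$. Define $d^+(i,j)=(d_h^+(i,j),d_v^+(i,j))=\big(\operatorname{des}^B(\varphi_{(i,j)}(\pi))-\operatorname{des}^B(\pi),\ \operatorname{ides}^B(\varphi_{(i,j)}(\pi))-\operatorname{ides}^B(\pi)\big)$ and $d^-(i,j)=(d_h^-(i,j),d_v^-(i,j))$ the same with $\overline{\varphi}_{(i,j)}$. Paths: for $p\in\{0,1\}$, the $p_h^+$-paths (resp. $p_h^-$-paths) are obtained by connecting grid points of $d_h^+$-type (resp. $d_h^-$-type) $p$ only along horizontal grid lines, and then connecting the resulting segments that do not span a full grid line by diagonal lines only if they touch the same filled square. For $q\in\{0,1\}$, the $q_v^+$-paths (resp. $q_v^-$-paths) are obtained analogously by connecting grid points of $d_v^+$-type (resp. $d_v^-$-type) $q$ only along vertical grid lines, then connecting the non-full segments by diagonal lines only if they touch the same filled square. *)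

theory Defs
  imports Main
begin

text \<open>
  The word \<open>\<pi>\<^sub>1 \<dots> \<pi>\<^sub>n\<close> is the function \<open>i \<mapsto> \<pi>\<^sub>i\<close>, extended by 0 outside \<open>{1..n}\<close>.
  This makes the representation unique and contains the convention \<open>\<pi>\<^sub>0 = 0\<close>.
\<close>

definition signed_perms :: "nat \<Rightarrow> (nat \<Rightarrow> int) set" where
  "signed_perms n =
    {\<pi>. bij_betw (\<lambda>i. nat \<bar>\<pi> i\<bar>) {1..n} {1..n} \<and> (\<forall>i. i \<notin> {1..n} \<longrightarrow> \<pi> i = 0)}"

definition inverse_sp :: "nat \<Rightarrow> (nat \<Rightarrow> int) \<Rightarrow> nat \<Rightarrow> int" where
  "inverse_sp n \<pi> k =
    (if k \<in> {1..n}
     then let i = the_inv_into {1..n} (\<lambda>i. nat \<bar>\<pi> i\<bar>) k in sgn (\<pi> i) * int i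
     else 0)"

lemma inverse_sp_apply:
  assumes "\<pi> \<in> signed_perms n" "i \<in> {1..n}"
  shows "inverse_sp n \<pi> (nat \<bar>\<pi> i\<bar>) = sgn (\<pi> i) * int i"
proof -
  have b: "bij_betw (\<lambda>i. nat \<bar>\<pi> i\<bar>) {1..n} {1..n}"
    using assms by (simp add: signed_perms_def)
  have m: "nat \<bar>\<pi> i\<bar> \<in> {1..n}"
    using bij_betwE[OF b] assms(2) by blast
  have "the_inv_into {1..n} (\<lambda>i. nat \<bar>\<pi> i\<bar>) (nat \<bar>\<pi> i\<bar>) = i"
    using the_inv_into_f_f[OF bij_betw_imp_inj_on[OF b] assms(2)] .
  with m show ?thesis
    by (simp add: inverse_sp_def Let_def)
qed

definition desB :: "nat \<Rightarrow> (nat \<Rightarrow> int) \<Rightarrow> nat" where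
  "desB n \<pi> = card {i \<in> {0..<n}. \<pi> i > \<pi> (Suc i)}"

definition idesB :: "nat \<Rightarrow> (nat \<Rightarrow> int) \<Rightarrow> nat" where
  "idesB n \<pi> = desB n (inverse_sp n \<pi>)"

definition shift :: "nat \<Rightarrow> int \<Rightarrow> int" where
  "shift j x = (if \<bar>x\<bar> < int j then x else if x \<ge> int j then x + 1 else x - 1)"

definition phi :: "nat \<Rightarrow> nat \<Rightarrow> (nat \<Rightarrow> int) \<Rightarrow> nat \<Rightarrow> int" where
  "phi i j \<pi> k =
    (if k = i then int j else if k < i then shift j (\<pi> k) else shift j (\<pi> (k - 1)))"

definition phi_bar :: "nat \<Rightarrow> nat \<Rightarrow> (nat \<Rightarrow> int) \<Rightarrow> nat \<Rightarrow> int" where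
  "phi_bar i j \<pi> k =
    (if k = i then - int j else if k < i then shift j (\<pi> k) else shift j (\<pi> (k - 1)))"

type_synonym point = "nat \<times> nat"

definition dh_pos :: "nat \<Rightarrow> (nat \<Rightarrow> int) \<Rightarrow> point \<Rightarrow> int" where
  "dh_pos n \<pi> = (\<lambda>(i, j). int (desB (n + 1) (phi i j \<pi>)) - int (desB n \<pi>))"

definition dv_pos :: "nat \<Rightarrow> (nat \<Rightarrow> int) \<Rightarrow> point \<Rightarrow> int" where
  "dv_pos n \<pi> = (\<lambda>(i, j). int (idesB (n + 1) (phi i j \<pi>)) - int (idesB n \<pi>))"

definition dh_neg :: "nat \<Rightarrow> (nat \<Rightarrow> int) \<Rightarrow> point \<Rightarrow> int" where
  "dh_neg n \<pi> = (\<lambda>(i, j). int (desB (n + 1) (phi_bar i j \<pi>)) - int (desB n \<pi>))"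

definition dv_neg :: "nat \<Rightarrow> (nat \<Rightarrow> int) \<Rightarrow> point \<Rightarrow> int" where
  "dv_neg n \<pi> = (\<lambda>(i, j). int (idesB (n + 1) (phi_bar i j \<pi>)) - int (idesB n \<pi>))"

text \<open>
  Rows are numbered from the top and columns from the left, and \<open>(i, j)\<close> is the northwest
  corner of the square in row \<open>i\<close> and column \<open>j\<close>.
\<close>

definition grid_points :: "nat \<Rightarrow> point set" where
  "grid_points n = {1..n + 1} \<times> {1..n + 1}"

definition h_lines :: "nat \<Rightarrow> point set set" where
  "h_lines n = {{i} \<times> {1..n + 1} | i. i \<in> {1..n + 1}}"

definition v_lines :: "nat \<Rightarrow> point set set" where
  "v_lines n = {{1..n + 1} \<times> {j} | j. j \<in> {1..n + 1}}"

definition positive_square :: "nat \<Rightarrow> (nat \<Rightarrow> int) \<Rightarrow> nat \<Rightarrow> nat \<Rightarrow> bool" where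
  "positive_square n \<pi> r c \<longleftrightarrow> r \<in> {1..n} \<and> c = nat \<bar>\<pi> r\<bar> \<and> \<pi> r > 0"

definition negative_square :: "nat \<Rightarrow> (nat \<Rightarrow> int) \<Rightarrow> nat \<Rightarrow> nat \<Rightarrow> bool" where
  "negative_square n \<pi> r c \<longleftrightarrow> r \<in> {1..n} \<and> c = nat \<bar>\<pi> r\<bar> \<and> \<pi> r < 0"

definition filled_square :: "nat \<Rightarrow> (nat \<Rightarrow> int) \<Rightarrow> nat \<Rightarrow> nat \<Rightarrow> bool" where
  "filled_square n \<pi> r c \<longleftrightarrow> positive_square n \<pi> r c \<or> negative_square n \<pi> r c"

definition corners :: "nat \<Rightarrow> nat \<Rightarrow> point set" where
  "corners r c = {r, r + 1} \<times> {c, c + 1}"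

definition points_of_type :: "nat \<Rightarrow> (point \<Rightarrow> int) \<Rightarrow> int \<Rightarrow> point set" where
  "points_of_type n d p = {x \<in> grid_points n. d x = p}"

definition h_segments :: "point set \<Rightarrow> point set set" where
  "h_segments X =
    {{i} \<times> {a..b} | i a b. 1 \<le> a \<and> a \<le> b \<and> {i} \<times> {a..b} \<subseteq> X
       \<and> (i, a - 1) \<notin> X \<and> (i, b + 1) \<notin> X}"

definition v_segments :: "point set \<Rightarrow> point set set" where
  "v_segments X =
    {{a..b} \<times> {j} | j a b. 1 \<le> a \<and> a \<le> b \<and> {a..b} \<times> {j} \<subseteq> X
       \<and> (a - 1, j) \<notin> X \<and> (b + 1, j) \<notin> X}"

definition line_steps :: "point set set \<Rightarrow> (point \<times> point) set" where
  "line_steps segs =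
    {((i, j), (i', j')) | i j i' j'. (\<exists>S \<in> segs. (i, j) \<in> S \<and> (i', j') \<in> S)
       \<and> (i = i' \<and> (j' = j + 1 \<or> j = j' + 1) \<or> j = j' \<and> (i' = i + 1 \<or> i = i' + 1))}"

text \<open>
  A segment touches a square if it meets it in a single corner; a segment running along a side
  of a square contains two corners and does not touch it in this sense. Two segments touching
  the same filled square, of either sign, in opposite corners are joined by the diagonal.
\<close>

definition diagonal_steps ::
  "nat \<Rightarrow> (nat \<Rightarrow> int) \<Rightarrow> point set set \<Rightarrow> point set set \<Rightarrow> (point \<times> point) set" where
  "diagonal_steps n \<pi> segs full_lines =
    {(u, v). \<exists>S \<in> segs - full_lines. \<exists>S' \<in> segs - full_lines. \<exists>r c.
       filled_square n \<pi> r c \<and> S \<inter> corners r c = {u} \<and> S' \<inter> corners r c = {v}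
       \<and> fst u \<noteq> fst v \<and> snd u \<noteq> snd v}"

text \<open>
  A path is a connected component of the graph with vertex set \<open>X\<close> and (symmetric) edge
  relation \<open>E\<close>, given by its vertices and its edges.
\<close>

type_synonym path = "point set \<times> (point \<times> point) set"

definition components :: "point set \<Rightarrow> (point \<times> point) set \<Rightarrow> path set" where
  "components X E = {(C, E \<inter> C \<times> C) | C. \<exists>x \<in> X. C = E\<^sup>* `` {x}}"

definition h_paths :: "nat \<Rightarrow> (nat \<Rightarrow> int) \<Rightarrow> (point \<Rightarrow> int) \<Rightarrow> int \<Rightarrow> path set" where
  "h_paths n \<pi> d p =
    (let X = points_of_type n d p; segs = h_segments X
     in components X (line_steps segs \<union> diagonal_steps n \<pi> segs (h_lines n)))"

definition v_paths :: "nat \<Rightarrow> (nat \<Rightarrow> int) \<Rightarrow> (point \<Rightarrow> int) \<Rightarrow> int \<Rightarrow> path set" where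
  "v_paths n \<pi> d p =
    (let X = points_of_type n d p; segs = v_segments X
     in components X (line_steps segs \<union> diagonal_steps n \<pi> segs (v_lines n)))"

definition consecutive :: "'a list \<Rightarrow> ('a \<times> 'a) set" where
  "consecutive xs = {(xs ! k, xs ! Suc k) | k. Suc k < length xs}"

text \<open>\<open>xs\<close> visits every vertex of the path once and uses exactly the edges of the path.\<close>

definition traverses :: "point list \<Rightarrow> path \<Rightarrow> bool" where
  "traverses xs P \<longleftrightarrow>
    xs \<noteq> [] \<and> distinct xs \<and> set xs = fst P
      \<and> snd P = consecutive xs \<union> (consecutive xs)\<inverse>"

definition southeast :: "nat \<Rightarrow> nat \<Rightarrow> point \<times> point" where
  "southeast r c = ((r, c), (r + 1, c + 1))"

definition northeast :: "nat \<Rightarrow> nat \<Rightarrow> point \<times> point" where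
  "northeast r c = ((r + 1, c), (r, c + 1))"

definition southwest :: "nat \<Rightarrow> nat \<Rightarrow> point \<times> point" where
  "southwest r c = ((r, c + 1), (r + 1, c))"

text \<open>
  A path travelling to the right encounters a square when it is at one of the two left corners
  of the square; a path travelling down, when it is at one of the two top corners.
  The argument \<open>sq\<close> is the set of squares that the path crosses, and \<open>across\<close> the
  direction in which it crosses them.
\<close>

definition goes_left_to_right ::
  "nat \<Rightarrow> (nat \<Rightarrow> nat \<Rightarrow> bool) \<Rightarrow> (nat \<Rightarrow> nat \<Rightarrow> point \<times> point) \<Rightarrow> path \<Rightarrow> bool" where
  "goes_left_to_right n sq across P \<longleftrightarrow>
    (\<exists>xs. traverses xs P \<and> snd (hd xs) = 1 \<and> snd (last xs) = n + 1 \<and>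
      (\<forall>(u, v) \<in> consecutive xs.
         (\<forall>r c. sq r c \<and> u \<in> {(r, c), (r + 1, c)} \<longrightarrow> (u, v) = across r c) \<and>
         ((\<nexists>r c. sq r c \<and> u \<in> {(r, c), (r + 1, c)}) \<longrightarrow> v = (fst u, snd u + 1))))"

definition goes_top_to_bottom ::
  "nat \<Rightarrow> (nat \<Rightarrow> nat \<Rightarrow> bool) \<Rightarrow> (nat \<Rightarrow> nat \<Rightarrow> point \<times> point) \<Rightarrow> path \<Rightarrow> bool" where
  "goes_top_to_bottom n sq across P \<longleftrightarrow>
    (\<exists>xs. traverses xs P \<and> fst (hd xs) = 1 \<and> fst (last xs) = n + 1 \<and>
      (\<forall>(u, v) \<in> consecutive xs.
         (\<forall>r c. sq r c \<and> u \<in> {(r, c), (r, c + 1)} \<longrightarrow> (u, v) = across r c) \<and>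
         ((\<nexists>r c. sq r c \<and> u \<in> {(r, c), (r, c + 1)}) \<longrightarrow> v = (fst u + 1, snd u))))"

end

theory Submission
  imports Defs
begin

text \<open>
  Inserting a positive square at \<open>(i, j)\<close> puts a value just below \<open>j\<close> (relative to the old
  values) between \<open>\<pi>\<^sub>i\<^sub>-\<^sub>1\<close> and \<open>\<pi>\<^sub>i\<close>. Hence along the \<open>i\<close>-th horizontal line the change of
  \<open>des\<^sup>B\<close> jumps exactly across the positive squares in rows \<open>i - 1\<close> and \<open>i\<close>, and the four
  corners of a positive square have types 0, 1 (top) and 1, 0 (bottom). So every point of a given
  type outside the last column has exactly one right neighbour in its path, and dually on the left.
  Negative squares follow from \<open>\<pi> \<mapsto> - \<pi>\<close>, which exchanges the two types, and vertical paths from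
  \<open>\<pi> \<mapsto> \<pi>\<^sup>-\<^sup>1\<close>, which transposes the grid.
\<close>

section \<open>Signed permutations and insertion of squares\<close>

lemma signed_perms_mem:
  assumes "\<pi> \<in> signed_perms n" "i \<in> {1..n}"
  shows "1 \<le> \<bar>\<pi> i\<bar>" "\<bar>\<pi> i\<bar> \<le> int n"
proof -
  have "nat \<bar>\<pi> i\<bar> \<in> {1..n}"
    using assms unfolding signed_perms_def by (blast dest: bij_betwE)
  then show "1 \<le> \<bar>\<pi> i\<bar>" "\<bar>\<pi> i\<bar> \<le> int n" by auto
qed

lemma signed_perms_outside:
  "\<pi> \<in> signed_perms n \<Longrightarrow> i \<notin> {1..n} \<Longrightarrow> \<pi> i = 0"
  by (simp add: signed_perms_def)

lemma signed_perms_abs_inj: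
  assumes "\<pi> \<in> signed_perms n" "i \<in> {1..n}" "k \<in> {1..n}" "\<bar>\<pi> i\<bar> = \<bar>\<pi> k\<bar>"
  shows "i = k"
  using assms inj_onD[of "\<lambda>i. nat \<bar>\<pi> i\<bar>" "{1..n}" i k]
  unfolding signed_perms_def bij_betw_def by simp

lemma signed_perms_abs_surj:
  assumes "\<pi> \<in> signed_perms n" "k \<in> {1..n}"
  obtains i where "i \<in> {1..n}" "k = nat \<bar>\<pi> i\<bar>"
  using assms unfolding signed_perms_def bij_betw_def by blast

text \<open>An injective self-map of a finite set is onto, so bijectivity reduces to bounds and
  distinctness of absolute values.\<close>

lemma signed_permsI:
  assumes "\<And>i. i \<in> {1..n} \<Longrightarrow> 1 \<le> \<bar>\<sigma> i\<bar> \<and> \<bar>\<sigma> i\<bar> \<le> int n"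
    and "\<And>i k. i \<in> {1..n} \<Longrightarrow> k \<in> {1..n} \<Longrightarrow> \<bar>\<sigma> i\<bar> = \<bar>\<sigma> k\<bar> \<Longrightarrow> i = k"
    and "\<And>i. i \<notin> {1..n} \<Longrightarrow> \<sigma> i = 0"
  shows "\<sigma> \<in> signed_perms n"
proof -
  have inj: "inj_on (\<lambda>i. nat \<bar>\<sigma> i\<bar>) {1..n}"
    using assms(2) by (intro inj_onI) (simp add: eq_nat_nat_iff)
  moreover have "(\<lambda>i. nat \<bar>\<sigma> i\<bar>) ` {1..n} \<subseteq> {1..n}"
    using assms(1) by (fastforce simp: nat_le_iff)
  ultimately have "bij_betw (\<lambda>i. nat \<bar>\<sigma> i\<bar>) {1..n} {1..n}"
    using endo_inj_surj[OF finite_atLeastAtMost] by (blast intro: bij_betw_imageI)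
  then show ?thesis using assms(3) by (simp add: signed_perms_def)
qed

text \<open>At \<open>k = 0\<close> the reason is that \<open>\<pi> 0 = 0\<close> while the first
  entry is nonzero. Every position is therefore a strict ascent or a strict descent.\<close>

lemma signed_perms_step_neq:
  assumes "\<pi> \<in> signed_perms n" "k < n"
  shows "\<pi> k \<noteq> \<pi> (Suc k)"
proof
  assume eq: "\<pi> k = \<pi> (Suc k)"
  have "\<pi> (Suc k) \<noteq> 0" using signed_perms_mem[OF assms(1), of "Suc k"] assms(2) by auto
  then have "k \<in> {1..n}" using eq signed_perms_outside[OF assms(1), of k] by auto
  then show False using signed_perms_abs_inj[OF assms(1), of k "Suc k"] eq assms(2) by simp
qed

section \<open>Relabelling of the old values under an insertion\<close>

lemma shift_uminus [simp]: "shift j (- x) = - shift j x" if "1 \<le> j"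
  using that by (auto simp: shift_def)

text \<open>Used to see that old entries which stay adjacent keep their comparison, so only
  comparisons next to the new entry can alter the descent count.\<close>

lemma shift_less_iff [simp]: "shift j x < shift j y \<longleftrightarrow> x < y" if "1 \<le> j"
  using that by (auto simp: shift_def)

lemma shift_0 [simp]: "shift j 0 = 0" if "1 \<le> j"
  using that by (simp add: shift_def)

text \<open>The old value \<open>j\<close> itself moves up to \<open>j + 1\<close>, hence the weak
  inequality on the right: the new entry sits just below the old value \<open>j\<close>.\<close>

lemma int_less_shift_iff: "int j < shift j x \<longleftrightarrow> int j \<le> x" if "1 \<le> j"
  using that by (auto simp: shift_def)

lemma shift_less_int_iff: "shift j x < int j \<longleftrightarrow> x < int j" if "1 \<le> j"
  using that by (auto simp: shift_def)

lemma abs_shift: "\<bar>shift j x\<bar> = (if \<bar>x\<bar> < int j then \<bar>x\<bar> else \<bar>x\<bar> + 1)"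
  by (auto simp: shift_def)

lemma abs_shift_neq: "\<bar>shift j x\<bar> \<noteq> int j"
  by (simp add: abs_shift)

lemma abs_shift_eq_iff: "\<bar>shift j x\<bar> = \<bar>shift j y\<bar> \<longleftrightarrow> \<bar>x\<bar> = \<bar>y\<bar>"
  by (simp add: abs_shift)

lemma sgn_shift [simp]: "sgn (shift j x) = sgn x" if "1 \<le> j"
  using that by (auto simp: shift_def sgn_if)

lemma phi_signed_perms:
  assumes "\<pi> \<in> signed_perms n" "i \<in> {1..n + 1}" "j \<in> {1..n + 1}"
  shows "phi i j \<pi> \<in> signed_perms (n + 1)"
proof (rule signed_permsI)
  fix k assume k: "k \<in> {1..n + 1}"
  consider "k = i" | "k < i" "k \<in> {1..n}" | "i < k" "k - 1 \<in> {1..n}"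
    using k assms(2) by (cases k i rule: linorder_cases) (auto simp: Suc_le_eq)
  then show "1 \<le> \<bar>phi i j \<pi> k\<bar> \<and> \<bar>phi i j \<pi> k\<bar> \<le> int (n + 1)"
  proof cases
    case 2
    then show ?thesis using signed_perms_mem[OF assms(1), of k] by (simp add: phi_def abs_shift)
  next
    case 3
    then show ?thesis
      using signed_perms_mem[OF assms(1), of "k - 1"] by (simp add: phi_def abs_shift)
  qed (use assms(3) in \<open>simp add: phi_def\<close>)
next
  fix k assume "k \<notin> {1..n + 1}"
  then show "phi i j \<pi> k = 0"
    using assms(2,3) signed_perms_outside[OF assms(1), of k]
      signed_perms_outside[OF assms(1), of "k - 1"]
    by (cases k) (simp_all add: phi_def)
next
  fix k l assume kl: "k \<in> {1..n + 1}" "l \<in> {1..n + 1}" "\<bar>phi i j \<pi> k\<bar> = \<bar>phi i j \<pi> l\<bar>"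
  \<comment> \<open>For a row other than the inserted row \<open>i\<close>, \<open>f\<close> gives
    the old row that it comes from.\<close>
  define f where "f k = (if k < i then k else k - 1)" for k
  have val: "\<bar>phi i j \<pi> k\<bar> = (if k = i then int j else \<bar>shift j (\<pi> (f k))\<bar>)" for k
    by (simp add: phi_def f_def)
  \<comment> \<open>No shifted entry has absolute value \<open>j\<close>, so two rows with equal
    absolute values are both old or both the inserted one.\<close>
  have f: "\<bar>\<pi> (f k)\<bar> = \<bar>\<pi> (f l)\<bar> \<and> k \<noteq> i \<and> l \<noteq> i \<or> k = i \<and> l = i"
    using kl(3) abs_shift_neq[of j "\<pi> (f k)"] abs_shift_neq[of j "\<pi> (f l)"]
    unfolding val by (simp add: abs_shift_eq_iff split: if_splits)
  show "k = l"
  proof (cases "k = i \<and> l = i")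
    case False
    with f have *: "\<bar>\<pi> (f k)\<bar> = \<bar>\<pi> (f l)\<bar>" "k \<noteq> i" "l \<noteq> i" by auto
    then have "f k \<in> {1..n}" "f l \<in> {1..n}" using kl assms(2) by (auto simp: f_def)
    then have "f k = f l" using signed_perms_abs_inj[OF assms(1)] *(1) by blast
    moreover have "m = (if f m < i then f m else Suc (f m))" if "m \<noteq> i" "m \<in> {1..n + 1}" for m
      using that by (auto simp: f_def)
    ultimately show ?thesis using *(2,3) kl(1,2) by metis
  qed simp
qed

section \<open>Inverses and negatives of insertions\<close>

lemma inverse_sp_outside: "k \<notin> {1..n} \<Longrightarrow> inverse_sp n \<pi> k = 0"
  by (auto simp: inverse_sp_def)

lemma inverse_sp_signed_perms:
  assumes "\<pi> \<in> signed_perms n"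
  shows "inverse_sp n \<pi> \<in> signed_perms n"
proof (rule signed_permsI)
  fix k assume "k \<in> {1..n}"
  then obtain i where i: "i \<in> {1..n}" "k = nat \<bar>\<pi> i\<bar>" by (rule signed_perms_abs_surj[OF assms])
  then show "1 \<le> \<bar>inverse_sp n \<pi> k\<bar> \<and> \<bar>inverse_sp n \<pi> k\<bar> \<le> int n"
    using inverse_sp_apply[OF assms i(1)] signed_perms_mem[OF assms i(1)]
    by (auto simp: abs_mult sgn_if)
next
  fix k l assume kl: "k \<in> {1..n}" "l \<in> {1..n}" "\<bar>inverse_sp n \<pi> k\<bar> = \<bar>inverse_sp n \<pi> l\<bar>"
  obtain i where i: "i \<in> {1..n}" "k = nat \<bar>\<pi> i\<bar>" by (rule signed_perms_abs_surj[OF assms kl(1)])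
  obtain m where m: "m \<in> {1..n}" "l = nat \<bar>\<pi> m\<bar>" by (rule signed_perms_abs_surj[OF assms kl(2)])
  have "i = m"
    using kl(3) inverse_sp_apply[OF assms i(1)] inverse_sp_apply[OF assms m(1)] i m
      signed_perms_mem[OF assms i(1)] signed_perms_mem[OF assms m(1)]
    by (auto simp: sgn_if split: if_splits)
  then show "k = l" using i m by simp
qed (rule inverse_sp_outside)

text \<open>Inversion reflects the grid in its main diagonal, which carries the new square from
  \<open>(i, j)\<close> to \<open>(j, i)\<close>. This later turns statements on
  \<open>idesB\<close> into statements on \<open>desB\<close>.\<close>

lemma inverse_sp_phi:
  assumes "\<pi> \<in> signed_perms n" "i \<in> {1..n + 1}" "j \<in> {1..n + 1}"
  shows "inverse_sp (n + 1) (phi i j \<pi>) = phi j i (inverse_sp n \<pi>)"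
proof
  fix k
  show "inverse_sp (n + 1) (phi i j \<pi>) k = phi j i (inverse_sp n \<pi>) k"
  proof (cases "k \<in> {1..n + 1}")
    case True
    \<comment> \<open>Addressing column \<open>k\<close> through the row \<open>m\<close> of its
      square makes the inverse explicit by \<open>inverse_sp_apply\<close>.\<close>
    then obtain m where m: "m \<in> {1..n + 1}" "k = nat \<bar>phi i j \<pi> m\<bar>"
      by (rule signed_perms_abs_surj[OF phi_signed_perms[OF assms]])
    have inv: "inverse_sp (n + 1) (phi i j \<pi>) k = sgn (phi i j \<pi> m) * int m"
      using inverse_sp_apply[OF phi_signed_perms[OF assms] m(1)] m(2) by simp
    show ?thesis
    proof (cases "m = i")
      case True
      then show ?thesis using inv m assms by (simp add: phi_def)
    next
      case False
      define l where "l = (if m < i then m else m - 1)"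
      have l: "l \<in> {1..n}" using False m(1) assms(2) by (auto simp: l_def)
      have phi: "phi i j \<pi> m = shift j (\<pi> l)" using False by (auto simp: phi_def l_def)
      note pl = signed_perms_mem[OF assms(1) l] inverse_sp_apply[OF assms(1) l]
      have "phi j i (inverse_sp n \<pi>) k = shift i (sgn (\<pi> l) * int l)"
      proof (cases "\<bar>\<pi> l\<bar> < int j")
        case True
        then have "k = nat \<bar>\<pi> l\<bar>" "k < j" using m phi by (auto simp: abs_shift)
        then show ?thesis using pl by (simp add: phi_def)
      next
        case False
        then have "k - 1 = nat \<bar>\<pi> l\<bar>" "j < k" using m phi pl by (auto simp: abs_shift nat_add_distrib)
        then show ?thesis using pl by (simp add: phi_def)
      qed
      \<comment> \<open>The old row \<open>l\<close> returns to its row \<open>m\<close> of the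
        enlarged grid: \<open>shift i\<close> adds one to the absolute value exactly when
        \<open>l\<close> is not above row \<open>i\<close>.\<close>
      also have "\<dots> = sgn (\<pi> l) * int m"
        using l pl(1) False assms(2) m(1) by (auto simp: l_def shift_def sgn_if)
      finally show ?thesis using inv phi assms(3) by simp
    qed
  next
    case False
    then show ?thesis
      using assms inverse_sp_outside[of k n \<pi>] inverse_sp_outside[of "k - 1" n \<pi>]
        inverse_sp_outside[of k "n + 1" "phi i j \<pi>"]
      by (cases k) (simp_all add: phi_def)
  qed
qed

lemma uminus_signed_perms: "- \<pi> \<in> signed_perms n" if "\<pi> \<in> signed_perms n"
  using that by (simp add: signed_perms_def)

lemma inverse_sp_uminus: "inverse_sp n (- \<pi>) = - inverse_sp n \<pi>"
  by (rule ext) (simp add: inverse_sp_def Let_def)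

text \<open>\<open>shift j\<close> is odd for positive \<open>j\<close>, so negating before and
  after an insertion only changes the sign of the inserted square. All questions on negative squares
  reduce to positive ones this way.\<close>

lemma phi_bar_eq: "phi_bar i j \<pi> = - phi i j (- \<pi>)" if "1 \<le> j"
  using that by (auto simp: fun_eq_iff phi_def phi_bar_def)

lemma inverse_sp_phi_bar:
  assumes "\<pi> \<in> signed_perms n" "i \<in> {1..n + 1}" "j \<in> {1..n + 1}"
  shows "inverse_sp (n + 1) (phi_bar i j \<pi>) = phi_bar j i (inverse_sp n \<pi>)"
  using assms inverse_sp_phi[OF uminus_signed_perms[OF assms(1)] assms(2,3)]
  by (simp add: phi_bar_eq inverse_sp_uminus)

section \<open>Change of the descent number under insertion\<close>

lemma desB_Suc: "desB (Suc n) \<pi> = desB n \<pi> + of_bool (\<pi> n > \<pi> (Suc n))"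
proof -
  have "{i \<in> {0..<Suc n}. \<pi> i > \<pi> (Suc i)} =
      (if \<pi> n > \<pi> (Suc n) then insert n {i \<in> {0..<n}. \<pi> i > \<pi> (Suc i)}
       else {i \<in> {0..<n}. \<pi> i > \<pi> (Suc i)})"
    by (auto simp: less_Suc_eq)
  then show ?thesis by (simp add: desB_def)
qed

text \<open>Neighbouring entries differ, so each of the \<open>n\<close> positions is a descent of
  exactly one of the two words.\<close>

lemma desB_uminus:
  assumes "\<pi> \<in> signed_perms n"
  shows "desB n \<pi> + desB n (- \<pi>) = n"
proof -
  \<comment> \<open>The word is kept fixed and only the length of the counted prefix varies.\<close>
  have "desB m \<pi> + desB m (- \<pi>) = m" if "m \<le> n" for m
    using that
  proof (induction m)
    case (Suc m)
    then show ?case using signed_perms_step_neq[OF assms, of m] by (auto simp: desB_Suc)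
  qed (simp add: desB_def)
  then show ?thesis by simp
qed

text \<open>A square in the new last row adds one comparison, with the old last entry, and removes
  none.\<close>

lemma desB_phi_last:
  assumes "1 \<le> j"
  shows "desB (Suc n) (phi (Suc n) j \<pi>) = desB n \<pi> + of_bool (int j \<le> \<pi> n)"
proof -
  have "desB m (phi (Suc n) j \<pi>) = desB m \<pi>" if "m \<le> n" for m
    using that
  proof (induction m)
    case (Suc m)
    then show ?case using assms by (simp add: desB_Suc phi_def)
  qed (simp add: desB_def)
  then show ?thesis using assms by (simp add: desB_Suc phi_def int_less_shift_iff)
qed

text \<open>The new entry separates entries \<open>m\<close> and \<open>Suc m\<close>: their
  comparison is replaced by two comparisons with \<open>j\<close>.\<close>

lemma desB_phi:
  assumes "1 \<le> j" "m < n"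
  shows "int (desB (Suc n) (phi (Suc m) j \<pi>)) =
    int (desB n \<pi>) + of_bool (int j \<le> \<pi> m) + of_bool (\<pi> (Suc m) < int j)
      - of_bool (\<pi> m > \<pi> (Suc m))"
  using assms(2)
proof (induction n)
  case (Suc n)
  show ?case
  proof (cases "m = n")
    \<comment> \<open>Here the new entry ends the prefix handled by \<open>desB_phi_last\<close>;
      one further comparison, with the shifted entry after it, remains to be added.\<close>
    case True
    then show ?thesis
      using desB_phi_last[OF assms(1), of n \<pi>] assms(1)
      by (simp add: desB_Suc[of "Suc n"] desB_Suc[of n \<pi>])
        (simp add: phi_def shift_less_int_iff)
  next
    case False
    then show ?thesis using Suc assms(1)
      by (simp add: desB_Suc[of "Suc n"] desB_Suc[of n \<pi>] phi_def)
  qed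
qed simp

lemma dh_pos_last:
  assumes "1 \<le> j"
  shows "dh_pos n \<pi> (n + 1, j) = of_bool (int j \<le> \<pi> n)"
  using desB_phi_last[OF assms, of n \<pi>] by (simp add: dh_pos_def)

lemma dh_pos_inner:
  assumes "1 \<le> j" "i \<in> {1..n}"
  shows "dh_pos n \<pi> (i, j) =
    of_bool (int j \<le> \<pi> (i - 1)) + of_bool (\<pi> i < int j) - of_bool (\<pi> (i - 1) > \<pi> i)"
  using desB_phi[OF assms(1), of "i - 1" n \<pi>] assms(2) by (cases i) (auto simp: dh_pos_def)

text \<open>Since \<open>\<pi> r = int c\<close>, the comparisons at each corner can be evaluated or
  cancel. Each type thus occupies one pair of opposite corners, which is what forces a diagonal step
  and fixes its direction.\<close>

lemma dh_pos_corners: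
  assumes "\<pi> \<in> signed_perms n" "positive_square n \<pi> r c"
  shows "dh_pos n \<pi> (r, c) = 0" "dh_pos n \<pi> (r, c + 1) = 1"
    "dh_pos n \<pi> (r + 1, c) = 1" "dh_pos n \<pi> (r + 1, c + 1) = 0"
proof -
  have r: "r \<in> {1..n}" and c: "1 \<le> c" "\<pi> r = int c"
    using assms(2) by (auto simp: positive_square_def)
  have ne: "\<pi> (r - 1) \<noteq> \<pi> r" using signed_perms_step_neq[OF assms(1), of "r - 1"] r by (cases r) auto
  show "dh_pos n \<pi> (r, c) = 0" "dh_pos n \<pi> (r, c + 1) = 1"
    using r c ne by (auto simp: dh_pos_inner)
  \<comment> \<open>For \<open>r = n\<close> the lower side lies on the last grid line, where only
    one comparison enters the type.\<close>
  have "dh_pos n \<pi> (r + 1, c) = 1 \<and> dh_pos n \<pi> (r + 1, c + 1) = 0"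
  proof (cases "r = n")
    case True
    then show ?thesis using c dh_pos_last[of c n \<pi>] dh_pos_last[of "c + 1" n \<pi>] by simp
  next
    case False
    then have "r + 1 \<in> {1..n}" "\<pi> (r + 1) \<noteq> \<pi> r"
      using r signed_perms_step_neq[OF assms(1), of r] by auto
    then show ?thesis
      using c dh_pos_inner[of c "r + 1" n \<pi>] dh_pos_inner[of "c + 1" "r + 1" n \<pi>] by auto
  qed
  then show "dh_pos n \<pi> (r + 1, c) = 1" "dh_pos n \<pi> (r + 1, c + 1) = 0" by auto
qed

text \<open>Raising \<open>j\<close> by one can change only a comparison with an entry equal to
  \<open>j\<close>, that is, with a positive square of column \<open>j\<close> just above or just
  below the line.\<close>

lemma dh_pos_step:
  assumes "\<pi> \<in> signed_perms n" "i \<in> {1..n + 1}" "1 \<le> j"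
    and "\<not> positive_square n \<pi> i j" "\<not> positive_square n \<pi> (i - 1) j"
  shows "dh_pos n \<pi> (i, j + 1) = dh_pos n \<pi> (i, j)"
proof -
  \<comment> \<open>On the top line the entry above is \<open>\<pi> 0 = 0\<close>, which differs
    from \<open>j\<close> because \<open>j\<close> is positive.\<close>
  have "\<pi> (i - 1) \<noteq> int j"
    using assms(2,3,5) signed_perms_outside[OF assms(1), of "i - 1"]
    by (cases "i - 1 \<in> {1..n}") (auto simp: positive_square_def)
  moreover have "\<pi> i \<noteq> int j" if "i \<le> n"
    using assms(2,3,4) that by (auto simp: positive_square_def)
  ultimately show ?thesis
    using assms(2,3) dh_pos_last[of j n \<pi>] dh_pos_last[of "j + 1" n \<pi>]
      dh_pos_inner[of j i n \<pi>] dh_pos_inner[of "j + 1" i n \<pi>]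
    by (cases "i = n + 1") auto
qed

section \<open>Horizontal paths\<close>

text \<open>Unique successors and predecessors rule out branching, and the column grows with every
  step of \<open>R\<close>, which rules out cycles. A component is thus a single chain, and it can
  stop only in the first and last columns.\<close>

lemma component_traversal:
  fixes X :: "point set"
  assumes R: "R \<subseteq> X \<times> X" and col: "\<And>u v. (u, v) \<in> R \<Longrightarrow> snd v = snd u + 1"
    and sv: "single_valued R" "single_valued (R\<inverse>)"
    and X: "\<And>u. u \<in> X \<Longrightarrow> 1 \<le> snd u \<and> snd u \<le> n + 1"
    and succ: "\<And>u. u \<in> X \<Longrightarrow> snd u \<le> n \<Longrightarrow> \<exists>v. (u, v) \<in> R"
    and pred: "\<And>v. v \<in> X \<Longrightarrow> 1 < snd v \<Longrightarrow> \<exists>u. (u, v) \<in> R"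
    and P: "P \<in> components X (R \<union> R\<inverse>)"
  shows "\<exists>xs. traverses xs P \<and> snd (hd xs) = 1 \<and> snd (last xs) = n + 1 \<and> consecutive xs \<subseteq> R"
proof -
  let ?E = "R \<union> R\<inverse>"
  obtain x where x: "x \<in> X" "P = (?E\<^sup>* `` {x}, ?E \<inter> ?E\<^sup>* `` {x} \<times> ?E\<^sup>* `` {x})"
    using P by (auto simp: components_def)
  \<comment> \<open>Induction on the column: following predecessors to the left ends in column
    1.\<close>
  have start: "\<exists>y \<in> X. snd y = 1 \<and> (y, z) \<in> R\<^sup>*" if "z \<in> X" "snd z = k" for z k
    using that
  proof (induction k arbitrary: z)
    case 0
    then show ?case using X[of z] by simp
  next
    case (Suc k)
    show ?case
    proof (cases "k = 0")
      case True
      then show ?thesis using Suc.prems by auto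
    next
      case False
      then obtain u where u: "(u, z) \<in> R" using pred[of z] Suc.prems by auto
      then have "u \<in> X" "snd u = k" using R col[OF u] Suc.prems by auto
      from Suc.IH[OF this] u show ?thesis by (blast intro: rtrancl_into_rtrancl)
    qed
  qed
  obtain y where y: "y \<in> X" "snd y = 1" "(y, x) \<in> R\<^sup>*"
    using start[OF x(1) refl] by blast
  \<comment> \<open>\<open>f\<close> selects a successor; iterating it \<open>n\<close> times from
    the starting point \<open>y\<close> lists the whole component.\<close>
  define f where "f u = (SOME v. (u, v) \<in> R)" for u
  have f: "(u, f u) \<in> R" if "u \<in> X" "snd u \<le> n" for u
    unfolding f_def using succ[OF that] by (rule someI_ex)
  define g where "g k = (f ^^ k) y" for k
  have gX: "g k \<in> X \<and> snd (g k) = k + 1" if "k \<le> n" for k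
    using that
  proof (induction k)
    case (Suc k)
    then have "(g k, g (Suc k)) \<in> R" using f by (simp add: g_def)
    then show ?case using R col[of "g k" "g (Suc k)"] Suc by auto
  qed (simp add: g_def y)
  have gR: "(g k, g (Suc k)) \<in> R" if "k < n" for k
    using f gX[of k] that by (simp add: g_def)
  define xs where "xs = map g [0..<Suc n]"
  have nth: "xs ! k = g k" if "k \<le> n" for k
    using that by (simp add: xs_def del: upt_Suc)
  have len: "length xs = Suc n" by (simp add: xs_def)
  have cons: "consecutive xs = {(g k, g (Suc k)) | k. k < n}"
    unfolding consecutive_def len by (intro Collect_cong ex_cong1) (auto simp: nth Suc_le_eq)
  have set: "set xs = g ` {..n}"
    by (simp add: xs_def atLeast0LessThan lessThan_Suc_atMost del: upt_Suc)
  \<comment> \<open>Closure of the list under \<open>R\<close>, here forwards and next backwards,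
    keeps the component inside the list and shows that it has no edges besides the steps of the
    list.\<close>
  have closed: "(u, v) \<in> consecutive xs \<and> v \<in> set xs" if uv: "(u, v) \<in> R" "u \<in> set xs" for u v
  proof -
    obtain k where k: "k \<le> n" "u = g k" using uv(2) unfolding set by blast
    have "v \<in> X" using R uv(1) by blast
    then have "k < n" using col[OF uv(1)] X[of v] gX[OF k(1)] k by simp
    then have "v = g (Suc k)" using single_valuedD[OF sv(1) uv(1)] gR[of k] k by simp
    then show ?thesis using \<open>k < n\<close> k set cons by auto
  qed
  have closed': "(u, v) \<in> consecutive xs \<and> u \<in> set xs" if uv: "(u, v) \<in> R" "v \<in> set xs" for u v
  proof -
    obtain k where k: "k \<le> n" "v = g k" using uv(2) unfolding set by blast
    have "u \<in> X" using R uv(1) by blast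
    then have "k \<noteq> 0" using col[OF uv(1)] X[of u] gX[OF k(1)] k by auto
    then obtain l where l: "k = Suc l" by (cases k) auto
    then have "u = g l"
      using single_valuedD[OF sv(2), of v u "g l"] uv(1) gR[of l] k by simp
    then show ?thesis using l k set cons by auto
  qed
  have xE: "(x, y) \<in> ?E\<^sup>*"
    using rtrancl_converseI[OF y(3)] by (rule subsetD[OF rtrancl_mono, rotated]) blast
  have "?E\<^sup>* `` {x} = set xs"
  proof
    have "v \<in> set xs" if "(y, v) \<in> ?E\<^sup>*" for v
      using that
    proof induction
      case base
      show ?case using set by (auto simp: g_def image_iff intro!: bexI[of _ 0])
    next
      case (step u v)
      then show ?case using closed closed' by blast
    qed
    moreover have "(y, x) \<in> ?E\<^sup>*" 
      using y(3) by (rule subsetD[OF rtrancl_mono, rotated]) blast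
    ultimately show "?E\<^sup>* `` {x} \<subseteq> set xs" by (auto dest: rtrancl_trans)
    have "(y, g k) \<in> ?E\<^sup>*" if "k \<le> n" for k
      using that
    proof (induction k)
      case (Suc k)
      then show ?case using gR[of k] by (auto intro: rtrancl_into_rtrancl)
    qed (simp add: g_def)
    then show "set xs \<subseteq> ?E\<^sup>* `` {x}" using set xE by (auto intro: rtrancl_trans)
  qed
  then have Pxs: "P = (set xs, ?E \<inter> set xs \<times> set xs)" using x by simp
  have consR: "consecutive xs \<subseteq> R" using cons gR by auto
  have cons_set: "consecutive xs \<subseteq> set xs \<times> set xs" unfolding cons set by auto
  have "?E \<inter> set xs \<times> set xs = consecutive xs \<union> (consecutive xs)\<inverse>"
    using closed consR cons_set by blast
  moreover have "distinct xs"
  proof -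
    \<comment> \<open>The column of \<open>g k\<close> is \<open>k + 1\<close>, so it determines
      \<open>k\<close>.\<close>
    have "inj_on g {..n}" using gX by (intro inj_onI) (metis add_right_cancel atMost_iff)
    then show ?thesis by (simp add: xs_def distinct_map atLeast0LessThan lessThan_Suc_atMost del: upt_Suc)
  qed
  moreover have "hd xs = g 0" "last xs = g n" 
    using hd_conv_nth[of xs] last_conv_nth[of xs] len nth by force+
  ultimately show ?thesis
    using Pxs consR gX[of 0] gX[of n] len by (intro exI[of _ xs]) (auto simp: traverses_def)
qed

section \<open>Maximal horizontal segments and their steps\<close>

text \<open>The run of points of \<open>X\<close> around \<open>(i, j)\<close> is extended as far as
  possible both ways; the grid bounds the extension to the right.\<close>

lemma h_segment_through:
  assumes "X \<subseteq> grid_points n" "(i, j) \<in> X"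
  obtains a b where "1 \<le> a" "a \<le> j" "j \<le> b" "{i} \<times> {a..b} \<in> h_segments X"
proof -
  have X: "1 \<le> k \<and> k \<le> n + 1" if "(i, k) \<in> X" for k
    using assms(1) that by (auto simp: grid_points_def)
  define a where "a = (LEAST a. {i} \<times> {a..j} \<subseteq> X)"
  define b where "b = (GREATEST b. {i} \<times> {j..b} \<subseteq> X \<and> j \<le> b)"
  have aX: "{i} \<times> {a..j} \<subseteq> X"
    unfolding a_def by (rule LeastI[of _ j]) (use assms(2) in auto)
  have aj: "a \<le> j"
    unfolding a_def by (rule Least_le) (use assms(2) in auto)
  then have "(i, a) \<in> X" using aX by auto
  then have a: "1 \<le> a" using X[of a] by blast
  have bound: "y \<le> n + 1" if "{i} \<times> {j..y} \<subseteq> X \<and> j \<le> y" for y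
  proof -
    have "(i, y) \<in> X" using that by auto
    then show ?thesis using X[of y] by blast
  qed
  have "(i, a - 1) \<notin> X"
  proof
    assume *: "(i, a - 1) \<in> X"
    have "{i} \<times> {a - 1..j} \<subseteq> X"
    proof clarify
      fix k assume "k \<in> {a - 1..j}"
      then have "k = a - 1 \<or> k \<in> {a..j}" by auto
      then show "(i, k) \<in> X" using * aX by auto
    qed
    \<comment> \<open>Contradicts \<open>1 \<le> a\<close>, which also ensures that the natural
      number \<open>a - 1\<close> is really smaller than \<open>a\<close>.\<close>
    then have "a \<le> a - 1" unfolding a_def by (rule Least_le)
    then show False using a by simp
  qed
  moreover have bX: "{i} \<times> {j..b} \<subseteq> X \<and> j \<le> b"
    unfolding b_def
    by (rule GreatestI_nat[where k = j and b = "n + 1"]) (use assms(2) bound in auto)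
  moreover have "(i, b + 1) \<notin> X"
  proof
    assume *: "(i, b + 1) \<in> X"
    have "{i} \<times> {j..b + 1} \<subseteq> X"
    proof clarify
      fix k assume "k \<in> {j..b + 1}"
      then have "k = b + 1 \<or> k \<in> {j..b}" by auto
      then show "(i, k) \<in> X" using * bX by auto
    qed
    then have "{i} \<times> {j..b + 1} \<subseteq> X \<and> j \<le> b + 1" using bX by auto
    from Greatest_le_nat[of "\<lambda>b. {i} \<times> {j..b} \<subseteq> X \<and> j \<le> b", OF this bound]
    have "b + 1 \<le> b" unfolding b_def[symmetric] .
    then show False by simp
  qed
  moreover have "{i} \<times> {a..b} \<subseteq> X"
  proof clarify
    fix k assume "k \<in> {a..b}"
    then have "k \<in> {a..j} \<or> k \<in> {j..b}" by auto
    then show "(i, k) \<in> X" using aX bX by auto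
  qed
  moreover have "a \<le> b" using aj bX by simp
  ultimately have "{i} \<times> {a..b} \<in> h_segments X" using a unfolding h_segments_def by blast
  then show ?thesis using that[of a b] a aj bX by blast
qed

lemma h_segments_subset: "S \<in> h_segments X \<Longrightarrow> S \<subseteq> X"
  by (auto simp: h_segments_def)

text \<open>Maximality: a segment cannot end between two neighbouring points that both lie in
  \<open>X\<close>.\<close>

lemma h_segment_adjacent:
  assumes "S \<in> h_segments X" "(i, j) \<in> X" "(i, j + 1) \<in> X"
  shows "(i, j) \<in> S \<longleftrightarrow> (i, j + 1) \<in> S"
proof -
  obtain k a b where S: "S = {k} \<times> {a..b}" "(k, a - 1) \<notin> X" "(k, b + 1) \<notin> X"
    using assms(1) unfolding h_segments_def by blast
  have "i = k \<Longrightarrow> j \<noteq> b \<and> a \<noteq> j + 1" using S assms by auto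
  then show ?thesis using S(1) by auto
qed

lemma line_steps_iff:
  "((i, j), (i', j')) \<in> line_steps G \<longleftrightarrow>
    (\<exists>S \<in> G. (i, j) \<in> S \<and> (i', j') \<in> S)
      \<and> (i = i' \<and> (j' = j + 1 \<or> j = j' + 1) \<or> j = j' \<and> (i' = i + 1 \<or> i = i' + 1))"
  by (simp add: line_steps_def)

text \<open>Segments disappear from the description: each lies in one row, and neighbours in
  \<open>X\<close> always share one. \<open>R\<close> keeps the left-to-right orientation.\<close>

lemma line_steps_h_segments:
  assumes "X \<subseteq> grid_points n"
  defines "R \<equiv> {((i, j), (i, j + 1)) | i j. (i, j) \<in> X \<and> (i, j + 1) \<in> X}"
  shows "line_steps (h_segments X) = R \<union> R\<inverse>"
proof (rule set_eqI)
  have R: "((i, j), (i', j')) \<in> R \<longleftrightarrow> (i, j) \<in> X \<and> (i', j') \<in> X \<and> i' = i \<and> j' = j + 1"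
    for i j i' j' by (auto simp: R_def)
  have common: "\<exists>S \<in> h_segments X. (i, j) \<in> S \<and> (i, j + 1) \<in> S"
    if ij: "(i, j) \<in> X" "(i, j + 1) \<in> X" for i j
  proof -
    obtain a b where ab: "1 \<le> a" "a \<le> j" "j \<le> b" "{i} \<times> {a..b} \<in> h_segments X"
      using h_segment_through[OF assms(1) ij(1)] by blast
    then have "(i, j) \<in> {i} \<times> {a..b}" by simp
    with h_segment_adjacent[OF ab(4) ij] show ?thesis by (intro bexI[OF _ ab(4)]) simp
  qed
  have row: "i = i'" if S: "S \<in> h_segments X" "(i, j) \<in> S" "(i', j') \<in> S" for S i j i' j'
  proof -
    obtain k a b where "S = {k} \<times> {a..b}" using S(1) unfolding h_segments_def by blast
    then show ?thesis using S(2,3) by simp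
  qed
  fix e :: "point \<times> point"
  obtain i j i' j' where e: "e = ((i, j), (i', j'))" by (metis surj_pair)
  show "e \<in> line_steps (h_segments X) \<longleftrightarrow> e \<in> R \<union> R\<inverse>"
  proof
    assume "e \<in> line_steps (h_segments X)"
    then obtain S where S: "S \<in> h_segments X" "(i, j) \<in> S" "(i', j') \<in> S"
      and adj: "i = i' \<and> (j' = j + 1 \<or> j = j' + 1) \<or> j = j' \<and> (i' = i + 1 \<or> i = i' + 1)"
      unfolding e line_steps_iff by blast
    have "(i, j) \<in> X" "(i', j') \<in> X" using h_segments_subset[OF S(1)] S(2,3) by blast+
    then show "e \<in> R \<union> R\<inverse>" using row[OF S] adj by (simp add: e R)
  next
    assume "e \<in> R \<union> R\<inverse>"
    then show "e \<in> line_steps (h_segments X)"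
      using common[of i j] common[of i j'] by (auto simp: e R line_steps_iff)
  qed
qed

lemma filled_square_bounds:
  assumes "\<pi> \<in> signed_perms n" "filled_square n \<pi> r c"
  shows "r \<in> {1..n}" "c \<in> {1..n}"
  using assms signed_perms_mem[OF assms(1), of r]
  by (auto simp: filled_square_def positive_square_def negative_square_def)

text \<open>Allows the two squares to have different signs, so a negative square excludes a positive
  one from its column.\<close>

lemma filled_square_unique_row:
  assumes "\<pi> \<in> signed_perms n" "filled_square n \<pi> r c" "filled_square n \<pi> r' c"
  shows "r = r'"
proof -
  have "r \<in> {1..n}" "r' \<in> {1..n}" "nat \<bar>\<pi> r\<bar> = nat \<bar>\<pi> r'\<bar>"
    using assms(2,3) by (auto simp: filled_square_def positive_square_def negative_square_def)
  then show ?thesis by (intro signed_perms_abs_inj[OF assms(1)]) (simp_all add: eq_nat_nat_iff)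
qed

section \<open>The graph of the points of one type\<close>

text \<open>For types 0 and 1 this is the diagonal joining the two corners of type \<open>p\<close>
  of a positive square, oriented to the right.\<close>

definition crossing :: "int \<Rightarrow> nat \<Rightarrow> nat \<Rightarrow> point \<times> point" where
  "crossing p = (if p = 0 then southeast else northeast)"

locale horizontal_type =
  fixes n :: nat and \<pi> :: "nat \<Rightarrow> int" and p :: int
  assumes \<pi>: "\<pi> \<in> signed_perms n" and p: "p \<in> {0, 1}"
begin

definition X :: "point set" where
  "X = points_of_type n (dh_pos n \<pi>) p"

text \<open>The expected path edges, all oriented to the right; \<open>h_paths_eq\<close> shows that
  their symmetric closure is the actual edge relation.\<close>

definition R :: "(point \<times> point) set" where
  "R = {((i, j), (i, j + 1)) | i j. (i, j) \<in> X \<and> (i, j + 1) \<in> X} \<union>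
    {crossing p r c | r c. positive_square n \<pi> r c}"

lemma mem_X:
  "(i, j) \<in> X \<longleftrightarrow> i \<in> {1..n + 1} \<and> j \<in> {1..n + 1} \<and> dh_pos n \<pi> (i, j) = p"
  by (simp add: X_def points_of_type_def grid_points_def)

lemma X_grid: "X \<subseteq> grid_points n"
  by (auto simp: X_def points_of_type_def)

lemma square_bounds:
  assumes "positive_square n \<pi> r c"
  shows "r \<in> {1..n}" "c \<in> {1..n}"
  using filled_square_bounds[OF \<pi>, of r c] assms by (simp_all add: filled_square_def)

lemma square_unique:
  "positive_square n \<pi> r c \<Longrightarrow> filled_square n \<pi> r' c \<Longrightarrow> r = r'"
  using filled_square_unique_row[OF \<pi>, of r c r'] by (simp add: filled_square_def)

lemma square_corners:
  assumes "positive_square n \<pi> r c"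
  shows "(r, c) \<in> X \<longleftrightarrow> p = 0" "(r, c + 1) \<in> X \<longleftrightarrow> p = 1"
    "(r + 1, c) \<in> X \<longleftrightarrow> p = 1" "(r + 1, c + 1) \<in> X \<longleftrightarrow> p = 0"
  using dh_pos_corners[OF \<pi> assms] square_bounds[OF assms] by (auto simp: mem_X)

lemma X_right_iff:
  assumes "i \<in> {1..n + 1}" "j \<in> {1..n}"
    and "\<not> positive_square n \<pi> i j" "\<not> positive_square n \<pi> (i - 1) j"
  shows "(i, j + 1) \<in> X \<longleftrightarrow> (i, j) \<in> X"
  using dh_pos_step[OF \<pi> assms(1) _ assms(3,4)] assms by (auto simp: mem_X)

text \<open>The other corner of the square on the same line has the other type, so the segment
  through \<open>u\<close> stops at \<open>u\<close> and cannot fill the line.\<close>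

lemma crossing_corner_segment:
  assumes "positive_square n \<pi> r c" "u \<in> corners r c" "u \<in> X"
  shows "\<exists>S \<in> h_segments X - h_lines n. S \<inter> corners r c = {u}"
proof -
  obtain i k where u: "u = (i, k)" by force
  obtain a b where ab: "1 \<le> a" "a \<le> k" "k \<le> b" "{i} \<times> {a..b} \<in> h_segments X"
    using h_segment_through[OF X_grid] assms(3) u by blast
  define S where "S = {i} \<times> {a..b}"
  have S: "S \<in> h_segments X" "S \<subseteq> {i} \<times> UNIV" "(i, k) \<in> S"
    using ab by (auto simp: S_def)
  \<comment> \<open>The column of the other corner on the line of \<open>u\<close>.\<close>
  define k' where "k' = (if k = c then c + 1 else c)"
  have ik: "i = r \<or> i = r + 1" "k = c \<or> k = c + 1"
    using assms(2) u by (auto simp: corners_def)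
  have "(i, k') \<notin> X"
    using ik square_corners[OF assms(1)] assms(3) p unfolding u k'_def by (elim disjE) simp_all
  then have k'S: "(i, k') \<notin> S" using h_segments_subset[OF S(1)] by blast
  have "k' \<in> {1..n + 1}"
    using square_bounds(2)[OF assms(1)] by (simp add: k'_def)
  then have "S \<noteq> {i'} \<times> {1..n + 1}" for i' using k'S S(3) by auto
  then have "S \<notin> h_lines n" unfolding h_lines_def by blast
  moreover have "corners r c \<inter> {i} \<times> UNIV = {(i, k), (i, k')}"
    using ik by (auto simp: k'_def corners_def)
  then have "S \<inter> corners r c = {u}" using S(2,3) k'S u by blast
  ultimately show ?thesis using S(1) by blast
qed

text \<open>A positive square has exactly two corners in \<open>X\<close>, and they are opposite, so
  it gives one diagonal in both orientations. Negative squares give none.\<close>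

lemma diagonal_steps_eq:
  defines "D \<equiv> {crossing p r c | r c. positive_square n \<pi> r c}"
  shows "diagonal_steps n \<pi> (h_segments X) (h_lines n) = D \<union> D\<inverse>"
proof (intro set_eqI iffI)
  fix e assume "e \<in> diagonal_steps n \<pi> (h_segments X) (h_lines n)"
  then obtain u v S S' r c where e: "e = (u, v)" and S: "S \<in> h_segments X" "S' \<in> h_segments X"
    and rc: "filled_square n \<pi> r c"
    and uv: "S \<inter> corners r c = {u}" "S' \<inter> corners r c = {v}" "fst u \<noteq> fst v" "snd u \<noteq> snd v"
    unfolding diagonal_steps_def by blast
  have X: "u \<in> X" "v \<in> X" and cor: "u \<in> corners r c" "v \<in> corners r c"
    using uv h_segments_subset[OF S(1)] h_segments_subset[OF S(2)] by blast+
  have pos: "positive_square n \<pi> r c"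
  \<comment> \<open>types do not change along the sides of a negative square, so no segment meets it in one corner\<close>
  proof (rule ccontr)
    assume neg: "\<not> positive_square n \<pi> r c"
    obtain i k where u: "u = (i, k)" by force
    have i: "i = r \<or> i = r + 1" "k = c \<or> k = c + 1" using cor u by (auto simp: corners_def)
    \<comment> \<open>The column of the square is already occupied, so \<open>X_right_iff\<close>
      applies to both of its horizontal sides.\<close>
    have none: "\<not> positive_square n \<pi> r' c" for r'
      using square_unique[of r' c r] rc neg by blast
    have "(i, c + 1) \<in> X \<longleftrightarrow> (i, c) \<in> X"
      using X_right_iff[of i c] none i filled_square_bounds[OF \<pi> rc] by auto
    then have "(i, c) \<in> X" "(i, c + 1) \<in> X" using X(1) i u by auto
    then have "(i, c) \<in> S \<longleftrightarrow> (i, c + 1) \<in> S" by (rule h_segment_adjacent[OF S(1)])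
    then have "(i, c) \<in> S" "(i, c + 1) \<in> S" using uv(1) i u by auto
    moreover have "(i, c) \<in> corners r c" "(i, c + 1) \<in> corners r c"
      using i by (auto simp: corners_def)
    ultimately have "(i, c) = u" "(i, c + 1) = u" using uv(1) by blast+
    then show False by (metis n_not_Suc_n prod.inject Suc_eq_plus1)
  qed
  have "(u, v) = crossing p r c \<or> (v, u) = crossing p r c"
    using X cor uv(3,4) square_corners[OF pos] p
    by (auto simp: crossing_def corners_def southeast_def northeast_def)
  then show "e \<in> D \<union> D\<inverse>" using pos e by (auto simp: D_def)
next
  fix e assume "e \<in> D \<union> D\<inverse>"
  then obtain r c where pos: "positive_square n \<pi> r c"
    and e: "e = crossing p r c \<or> prod.swap e = crossing p r c"
    by (auto simp: D_def)
  obtain u v where uv: "e = (u, v)" by (cases e)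
  have cor: "u \<in> corners r c" "v \<in> corners r c" "u \<in> X" "v \<in> X" "fst u \<noteq> fst v" "snd u \<noteq> snd v"
    using e uv square_corners[OF pos] p
    by (auto simp: crossing_def corners_def southeast_def northeast_def split: if_splits)
  have "filled_square n \<pi> r c" using pos by (simp add: filled_square_def)
  then show "e \<in> diagonal_steps n \<pi> (h_segments X) (h_lines n)"
    using crossing_corner_segment[OF pos cor(1,3)] crossing_corner_segment[OF pos cor(2,4)] cor(5,6) uv
    unfolding diagonal_steps_def by blast
qed

lemma h_paths_eq: "h_paths n \<pi> (dh_pos n \<pi>) p = components X (R \<union> R\<inverse>)"
proof -
  have "line_steps (h_segments X) \<union> diagonal_steps n \<pi> (h_segments X) (h_lines n) = R \<union> R\<inverse>"
    unfolding line_steps_h_segments[OF X_grid] diagonal_steps_eq R_def by blast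
  then show ?thesis by (simp add: h_paths_def Let_def flip: X_def)
qed

lemma R_line: "(i, j) \<in> X \<Longrightarrow> (i, j + 1) \<in> X \<Longrightarrow> ((i, j), (i, j + 1)) \<in> R"
  unfolding R_def by blast

lemma R_crossing: "positive_square n \<pi> r c \<Longrightarrow> crossing p r c \<in> R"
  unfolding R_def by blast

text \<open>The exclusion of squares in the \<open>line\<close> case holds because the two corners
  of a positive square on one horizontal line have different types.\<close>

lemma R_cases:
  assumes "(u, v) \<in> R"
  obtains (line) i j where "u = (i, j)" "v = (i, j + 1)" "(i, j) \<in> X" "(i, j + 1) \<in> X"
      "\<And>r. positive_square n \<pi> r j \<Longrightarrow> r \<noteq> i \<and> r + 1 \<noteq> i"
  | (crossing) r c where "positive_square n \<pi> r c" "(u, v) = crossing p r c"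
proof -
  consider i j where "u = (i, j)" "v = (i, j + 1)" "(i, j) \<in> X" "(i, j + 1) \<in> X" |
    r c where "positive_square n \<pi> r c" "(u, v) = crossing p r c"
    using assms unfolding R_def by blast
  then show ?thesis
  proof cases
    case (1 i j)
    have "r \<noteq> i \<and> r + 1 \<noteq> i" if "positive_square n \<pi> r j" for r
      using square_corners[OF that] 1(3,4) p by auto
    with 1 line show ?thesis by blast
  qed (rule crossing)
qed

lemma crossing_eqD:
  assumes "(u, v) = crossing p r c"
  shows "u \<in> {(r, c), (r + 1, c)}" "v \<in> {(r, c + 1), (r + 1, c + 1)}"
  using assms by (auto simp: crossing_def southeast_def northeast_def split: if_splits)

lemma positive_square_unique:
  "positive_square n \<pi> r c \<Longrightarrow> positive_square n \<pi> r' c \<Longrightarrow> r = r'"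
  using square_unique[of r c r'] by (simp add: filled_square_def)

text \<open>Serves twice: it is the step condition of \<open>goes_left_to_right\<close>, and it
  makes successors unique.\<close>

lemma R_forward:
  assumes "(u, v) \<in> R"
  shows "positive_square n \<pi> r c \<Longrightarrow> u \<in> {(r, c), (r + 1, c)} \<Longrightarrow> (u, v) = crossing p r c"
    and "\<nexists>r c. positive_square n \<pi> r c \<and> u \<in> {(r, c), (r + 1, c)} \<Longrightarrow> v = (fst u, snd u + 1)"
proof -
  show "(u, v) = crossing p r c" if "positive_square n \<pi> r c" "u \<in> {(r, c), (r + 1, c)}"
    using assms
  proof (cases rule: R_cases)
    case (line i j)
    then show ?thesis using that by auto
  next
    case (crossing r' c')
    then have "c' = c" using crossing_eqD(1)[OF crossing(2)] that(2) by auto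
    then have "r' = r" using positive_square_unique crossing(1) that(1) by blast
    then show ?thesis using crossing(2) \<open>c' = c\<close> by simp
  qed
  show "v = (fst u, snd u + 1)" if "\<nexists>r c. positive_square n \<pi> r c \<and> u \<in> {(r, c), (r + 1, c)}"
    using assms
  proof (cases rule: R_cases)
    case (crossing r c)
    then show ?thesis using that crossing_eqD(1) by blast
  qed simp
qed

text \<open>The mirror image with right corners in place of left ones, needed for the uniqueness of
  predecessors.\<close>

lemma R_backward:
  assumes "(u, v) \<in> R"
  shows "positive_square n \<pi> r c \<Longrightarrow> v \<in> {(r, c + 1), (r + 1, c + 1)} \<Longrightarrow> (u, v) = crossing p r c"
    and "\<nexists>r c. positive_square n \<pi> r c \<and> v \<in> {(r, c + 1), (r + 1, c + 1)} \<Longrightarrow>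
      v = (fst u, snd u + 1)"
proof -
  show "(u, v) = crossing p r c"
    if "positive_square n \<pi> r c" "v \<in> {(r, c + 1), (r + 1, c + 1)}"
    using assms
  proof (cases rule: R_cases)
    case (line i j)
    then show ?thesis using that by auto
  next
    case (crossing r' c')
    then have "c' = c" using crossing_eqD(2)[OF crossing(2)] that(2) by auto
    then have "r' = r" using positive_square_unique crossing(1) that(1) by blast
    then show ?thesis using crossing(2) \<open>c' = c\<close> by simp
  qed
  show "v = (fst u, snd u + 1)"
    if "\<nexists>r c. positive_square n \<pi> r c \<and> v \<in> {(r, c + 1), (r + 1, c + 1)}"
    using assms
  proof (cases rule: R_cases)
    case (crossing r c)
    then show ?thesis using that crossing_eqD(2) by blast
  qed simp
qed

lemma R_subset: "R \<subseteq> X \<times> X"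
  using square_corners p by (auto simp: R_def crossing_def southeast_def northeast_def)

lemma R_column: "(u, v) \<in> R \<Longrightarrow> snd v = snd u + 1"
  by (auto simp: R_def crossing_def southeast_def northeast_def split: if_splits)

lemma single_valued_R: "single_valued R"
proof (rule single_valuedI)
  fix u v w assume R: "(u, v) \<in> R" "(u, w) \<in> R"
  show "v = w"
  proof (cases "\<exists>r c. positive_square n \<pi> r c \<and> u \<in> {(r, c), (r + 1, c)}")
    case True
    then show ?thesis using R_forward(1)[OF R(1)] R_forward(1)[OF R(2)] by (metis prod.inject)
  next
    case False
    then show ?thesis using R_forward(2)[OF R(1)] R_forward(2)[OF R(2)] by simp
  qed
qed

lemma single_valued_converse_R: "single_valued (R\<inverse>)"
proof (rule single_valuedI)
  fix u v w assume "(v, u) \<in> R\<inverse>" "(v, w) \<in> R\<inverse>"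
  then have R: "(u, v) \<in> R" "(w, v) \<in> R" by auto
  show "u = w"
  proof (cases "\<exists>r c. positive_square n \<pi> r c \<and> v \<in> {(r, c + 1), (r + 1, c + 1)}")
    case True
    then show ?thesis using R_backward(1)[OF R(1)] R_backward(1)[OF R(2)] by (metis prod.inject)
  next
    case False
    then show ?thesis using R_backward(2)[OF R(1)] R_backward(2)[OF R(2)] by (simp add: prod_eq_iff)
  qed
qed

text \<open>Either the type persists along the line, or \<open>u\<close> is a left corner of a
  positive square and the diagonal starts there.\<close>

lemma R_succ:
  assumes "u \<in> X" "snd u \<le> n"
  shows "\<exists>v. (u, v) \<in> R"
proof -
  obtain i j where u: "u = (i, j)" by force
  have ij: "i \<in> {1..n + 1}" "j \<in> {1..n}" using assms u by (auto simp: mem_X)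
  consider "positive_square n \<pi> i j" | "positive_square n \<pi> (i - 1) j" |
    "(i, j + 1) \<in> X" using X_right_iff[OF ij] assms u by blast
  then show ?thesis
  proof cases
    case 1
    \<comment> \<open>\<open>u\<close> is the northwest corner of the square; in the next case it is
      the southwest one, which has type 1.\<close>
    then have "p = 0" using square_corners(1) assms u by blast
    then have "crossing p i j = (u, (i + 1, j + 1))" using u by (simp add: crossing_def southeast_def)
    then show ?thesis using R_crossing[OF 1] by auto
  next
    case 2
    then have "p = 1" using square_corners(3)[OF 2] assms u ij by simp
    then have "crossing p (i - 1) j = (u, (i - 1, j + 1))"
      using u ij by (simp add: crossing_def northeast_def)
    then show ?thesis using R_crossing[OF 2] by auto
  next
    case 3
    then show ?thesis using R_line assms u by blast
  qed
qed

lemma R_pred: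
  assumes "v \<in> X" "1 < snd v"
  shows "\<exists>u. (u, v) \<in> R"
proof -
  obtain i k where "v = (i, k)" by force
  \<comment> \<open>A square ending at \<open>v\<close> lies in the column \<open>j\<close> to its
    left.\<close>
  then obtain j where v: "v = (i, j + 1)" using assms(2) by (cases k) auto
  have ij: "i \<in> {1..n + 1}" "j \<in> {1..n}" using assms v by (auto simp: mem_X)
  consider "positive_square n \<pi> i j" | "positive_square n \<pi> (i - 1) j" |
    "(i, j) \<in> X" using X_right_iff[OF ij] assms v by blast
  then show ?thesis
  proof cases
    case 1
    then have "p = 1" using square_corners(2) assms v by blast
    then have "crossing p i j = ((i + 1, j), v)" using v by (simp add: crossing_def northeast_def)
    then show ?thesis using R_crossing[OF 1] by auto
  next
    case 2
    then have "p = 0" using square_corners(4)[OF 2] assms v ij by simp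
    then have "crossing p (i - 1) j = ((i - 1, j), v)"
      using v ij by (simp add: crossing_def southeast_def)
    then show ?thesis using R_crossing[OF 2] by auto
  next
    case 3
    then show ?thesis using R_line assms v by blast
  qed
qed

lemma h_path_crosses_positive_squares:
  assumes "P \<in> h_paths n \<pi> (dh_pos n \<pi>) p"
  shows "goes_left_to_right n (positive_square n \<pi>) (crossing p) P"
proof -
  have "1 \<le> snd u \<and> snd u \<le> n + 1" if "u \<in> X" for u
    using that by (cases u) (simp add: mem_X)
  from component_traversal[OF R_subset R_column single_valued_R single_valued_converse_R this
      R_succ R_pred assms[unfolded h_paths_eq]]
  obtain xs where xs: "traverses xs P" "snd (hd xs) = 1" "snd (last xs) = n + 1"
    "consecutive xs \<subseteq> R"
    by blast
  have "(\<forall>r c. positive_square n \<pi> r c \<and> u \<in> {(r, c), (r + 1, c)} \<longrightarrow> (u, v) = crossing p r c) \<and>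
      ((\<nexists>r c. positive_square n \<pi> r c \<and> u \<in> {(r, c), (r + 1, c)}) \<longrightarrow> v = (fst u, snd u + 1))"
    if "(u, v) \<in> consecutive xs" for u v
    using R_forward[of u v] xs(4) that by blast
  then show ?thesis using xs(1-3) unfolding goes_left_to_right_def by blast
qed

end

section \<open>Negative squares and vertical paths\<close>

lemma h_paths_dh_pos:
  assumes "\<pi> \<in> signed_perms n" "p \<in> {0, 1}" "P \<in> h_paths n \<pi> (dh_pos n \<pi>) p"
  shows "goes_left_to_right n (positive_square n \<pi>) (crossing p) P"
proof -
  interpret horizontal_type n \<pi> p by standard fact+
  show ?thesis using assms(3) by (rule h_path_crosses_positive_squares)
qed

text \<open>By \<open>desB_uminus\<close>, negation complements descent numbers to
  \<open>n + 1\<close> after the insertion and to \<open>n\<close> before it; the difference of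
  these totals is the 1.\<close>

lemma dh_neg_eq:
  assumes "\<pi> \<in> signed_perms n" "x \<in> grid_points n"
  shows "dh_neg n \<pi> x = 1 - dh_pos n (- \<pi>) x"
proof -
  obtain i j where x: "x = (i, j)" "i \<in> {1..n + 1}" "j \<in> {1..n + 1}"
    using assms(2) by (auto simp: grid_points_def)
  have "desB (n + 1) (phi i j (- \<pi>)) + desB (n + 1) (phi_bar i j \<pi>) = n + 1"
    using desB_uminus[OF phi_signed_perms[OF uminus_signed_perms[OF assms(1)] x(2,3)]] x(3)
    by (simp add: phi_bar_eq)
  moreover have "desB n \<pi> + desB n (- \<pi>) = n" by (rule desB_uminus[OF assms(1)])
  ultimately show ?thesis by (simp add: x dh_neg_def dh_pos_def)
qed

lemma positive_square_uminus: "positive_square n (- \<pi>) = negative_square n \<pi>"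
  by (simp add: fun_eq_iff positive_square_def negative_square_def)

lemma negative_square_uminus: "negative_square n (- \<pi>) = positive_square n \<pi>"
  by (simp add: fun_eq_iff positive_square_def negative_square_def)

lemma filled_square_uminus: "filled_square n (- \<pi>) = filled_square n \<pi>"
  by (auto simp: fun_eq_iff filled_square_def positive_square_uminus negative_square_uminus)

text \<open>Diagonals depend on filled squares only, which negation preserves, so just the type is
  exchanged.\<close>

lemma h_paths_dh_neg_eq:
  assumes "\<pi> \<in> signed_perms n"
  shows "h_paths n \<pi> (dh_neg n \<pi>) p = h_paths n (- \<pi>) (dh_pos n (- \<pi>)) (1 - p)"
proof -
  have "points_of_type n (dh_neg n \<pi>) p = points_of_type n (dh_pos n (- \<pi>)) (1 - p)"
    using dh_neg_eq[OF assms] by (auto simp: points_of_type_def)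
  then show ?thesis by (simp add: h_paths_def diagonal_steps_def filled_square_uminus)
qed

lemma h_paths_dh_neg:
  assumes "\<pi> \<in> signed_perms n" "p \<in> {0, 1}" "P \<in> h_paths n \<pi> (dh_neg n \<pi>) p"
  shows "goes_left_to_right n (negative_square n \<pi>) (crossing (1 - p)) P"
  using h_paths_dh_pos[OF uminus_signed_perms[OF assms(1)], of "1 - p" P] assms(2,3)
  by (auto simp: h_paths_dh_neg_eq[OF assms(1)] positive_square_uminus)

section \<open>Reflection of the grid in its main diagonal\<close>

abbreviation transpose_edge :: "point \<times> point \<Rightarrow> point \<times> point" where
  "transpose_edge \<equiv> map_prod prod.swap prod.swap"

definition transpose_path :: "path \<Rightarrow> path" where
  "transpose_path = map_prod ((`) prod.swap) ((`) transpose_edge)"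

lemma mem_swap_image: "(i, j) \<in> prod.swap ` S \<longleftrightarrow> (j, i) \<in> S"
  by force

lemma mem_transpose_image:
  "(u, v) \<in> transpose_edge ` E \<longleftrightarrow> (prod.swap u, prod.swap v) \<in> E"
  by (auto intro: image_eqI[of _ _ "(prod.swap u, prod.swap v)"])

lemma swap_image_singleton: "prod.swap ` ({i} \<times> A) = A \<times> {i}"
  by auto

lemma v_segments_transpose: "v_segments X = (`) prod.swap ` h_segments (prod.swap ` X)"
proof -
  have sub: "{i} \<times> A \<subseteq> prod.swap ` X \<longleftrightarrow> A \<times> {i} \<subseteq> X" for i A
    by (auto simp: mem_swap_image)
  have "(`) prod.swap ` {{i} \<times> {a..b} | i a b. Q i a b} = {{a..b} \<times> {i} | i a b. Q i a b}"
    for Q :: "nat \<Rightarrow> nat \<Rightarrow> nat \<Rightarrow> bool"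
    unfolding swap_image_singleton[symmetric] by blast
  then show ?thesis by (simp add: v_segments_def h_segments_def sub mem_swap_image)
qed

lemma v_lines_transpose: "v_lines n = (`) prod.swap ` h_lines n"
  unfolding v_lines_def h_lines_def swap_image_singleton[symmetric] by blast

lemma line_steps_transpose:
  "line_steps ((`) prod.swap ` G) = transpose_edge ` line_steps G"
proof (rule set_eqI)
  fix e :: "point \<times> point"
  obtain i j i' j' where e: "e = ((i, j), (i', j'))" by (metis surj_pair)
  show "e \<in> line_steps ((`) prod.swap ` G) \<longleftrightarrow> e \<in> transpose_edge ` line_steps G"
    unfolding e mem_transpose_image swap_simp line_steps_iff by (auto simp: mem_swap_image)
qed

lemma corners_transpose: "prod.swap ` corners r c = corners c r"
  by (auto simp: corners_def)

lemma swap_image_inter_corners: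
  "prod.swap ` S \<inter> corners r c = {u} \<longleftrightarrow> S \<inter> corners c r = {prod.swap u}"
proof -
  have "prod.swap ` S \<inter> corners r c = prod.swap ` (S \<inter> corners c r)"
    by (simp add: image_Int corners_transpose)
  moreover have "{u} = prod.swap ` {prod.swap u}" by simp
  ultimately show ?thesis by (metis inj_image_eq_iff inj_swap)
qed

lemma diagonal_steps_transpose:
  assumes "\<And>r c. filled_square n \<pi> r c \<longleftrightarrow> filled_square n \<sigma> c r"
  shows "diagonal_steps n \<pi> ((`) prod.swap ` G) ((`) prod.swap ` L) =
    transpose_edge ` diagonal_steps n \<sigma> G L"
proof -
  \<comment> \<open>Needed to move the image out of the set difference of segments and full
    lines.\<close>
  have inj: "inj ((`) (prod.swap :: point \<Rightarrow> point))"
    by (rule injI) (simp add: inj_image_eq_iff)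
  have "(u, v) \<in> diagonal_steps n \<pi> ((`) prod.swap ` G) ((`) prod.swap ` L) \<longleftrightarrow>
      (prod.swap u, prod.swap v) \<in> diagonal_steps n \<sigma> G L" for u v
    unfolding diagonal_steps_def image_set_diff[OF inj, symmetric] mem_Collect_eq case_prod_conv
      bex_simps swap_image_inter_corners assms fst_swap snd_swap
    by blast
  then show ?thesis by (auto simp: mem_transpose_image simp del: map_prod_simp)
qed

lemma rtrancl_transpose:
  "(transpose_edge ` E)\<^sup>* `` {prod.swap x} = prod.swap ` (E\<^sup>* `` {x})"
proof -
  have fwd: "(prod.swap u, prod.swap v) \<in> (transpose_edge ` E)\<^sup>*" if "(u, v) \<in> E\<^sup>*" for E u v
    using that
  proof induction
    case (step v w)
    then show ?case by (auto simp: mem_transpose_image intro: rtrancl_into_rtrancl)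
  qed simp
  \<comment> \<open>Transposition is an involution, so the converse is \<open>fwd\<close> applied to
    the transposed relation.\<close>
  have "transpose_edge (transpose_edge e) = e" for e by (cases e) simp
  then have "transpose_edge ` transpose_edge ` E = E" by (simp add: image_image)
  then have "(prod.swap u, prod.swap v) \<in> (transpose_edge ` E)\<^sup>* \<longleftrightarrow> (u, v) \<in> E\<^sup>*" for u v
    using fwd[of u v E] fwd[of "prod.swap u" "prod.swap v" "transpose_edge ` E"] by auto
  note iff = this[of x]
  show ?thesis
  proof (rule set_eqI)
    fix w :: point
    obtain i j where "w = prod.swap (i, j)" by (metis swap_swap surj_pair)
    then show "w \<in> (transpose_edge ` E)\<^sup>* `` {prod.swap x} \<longleftrightarrow> w \<in> prod.swap ` (E\<^sup>* `` {x})"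
      using iff[of "(i, j)"] by (simp add: mem_swap_image)
  qed
qed

lemma components_transpose:
  "components (prod.swap ` X) (transpose_edge ` E) = transpose_path ` components X E"
proof -
  have "transpose_edge ` E \<inter> (prod.swap ` C) \<times> (prod.swap ` C) = transpose_edge ` (E \<inter> C \<times> C)" for C
  proof (rule set_eqI)
    fix e :: "point \<times> point"
    obtain i j i' j' where e: "e = ((i, j), (i', j'))" by (metis surj_pair)
    show "e \<in> transpose_edge ` E \<inter> (prod.swap ` C) \<times> (prod.swap ` C) \<longleftrightarrow>
        e \<in> transpose_edge ` (E \<inter> C \<times> C)"
      unfolding e by (simp add: mem_transpose_image mem_swap_image)
  qed
  moreover have "components X E = (\<lambda>x. (E\<^sup>* `` {x}, E \<inter> (E\<^sup>* `` {x}) \<times> (E\<^sup>* `` {x}))) ` X" for X E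
    by (auto simp: components_def)
  ultimately show ?thesis
    by (simp add: image_image rtrancl_transpose transpose_path_def)
qed

text \<open>Segments, full lines, steps and components all commute with the reflection; only the
  squares and the types have to be matched.\<close>

lemma v_paths_transpose:
  assumes "\<And>r c. filled_square n \<pi> r c \<longleftrightarrow> filled_square n \<sigma> c r"
    and "\<And>x. x \<in> grid_points n \<Longrightarrow> d x = d' (prod.swap x)"
  shows "v_paths n \<pi> d p = transpose_path ` h_paths n \<sigma> d' p"
proof -
  have "prod.swap ` grid_points n = grid_points n" by (auto simp: grid_points_def)
  then have X: "points_of_type n d p = prod.swap ` points_of_type n d' p"
    using assms(2) by (auto simp: points_of_type_def image_iff grid_points_def)
  \<comment> \<open>Cancels the inner reflection produced by \<open>v_segments_transpose\<close>;
    \<open>X\<close> itself is unfolded only afterwards, for the vertex set.\<close>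
  have XX: "prod.swap ` points_of_type n d p = points_of_type n d' p" by (simp add: X image_image)
  show ?thesis
    unfolding v_paths_def h_paths_def Let_def v_segments_transpose XX v_lines_transpose
      line_steps_transpose diagonal_steps_transpose[OF assms(1)] image_Un[symmetric]
    unfolding X components_transpose ..
qed

lemma consecutive_map: "consecutive (map f xs) = map_prod f f ` consecutive xs"
proof -
  have image: "consecutive ys = (\<lambda>k. (ys ! k, ys ! Suc k)) ` {k. Suc k < length ys}" for ys :: "'c list"
    by (auto simp: consecutive_def)
  show ?thesis
    unfolding image[of xs] image[of "map f xs"] by (simp add: image_image cong: image_cong_simp)
qed

text \<open>The reflected list of points is the traversal, since left corners become top corners and
  a step right becomes a step down.\<close>

lemma goes_top_to_bottom_transpose:
  assumes "goes_left_to_right n sq' across' P"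
    and sq: "\<And>r c. sq r c \<longleftrightarrow> sq' c r"
    and across: "\<And>r c. across r c = transpose_edge (across' c r)"
  shows "goes_top_to_bottom n sq across (transpose_path P)"
proof -
  obtain xs where xs: "traverses xs P" "snd (hd xs) = 1" "snd (last xs) = n + 1"
    and steps: "\<And>u v. (u, v) \<in> consecutive xs \<Longrightarrow>
      (\<forall>r c. sq' r c \<and> u \<in> {(r, c), (r + 1, c)} \<longrightarrow> (u, v) = across' r c) \<and>
      ((\<nexists>r c. sq' r c \<and> u \<in> {(r, c), (r + 1, c)}) \<longrightarrow> v = (fst u, snd u + 1))"
    using assms(1) unfolding goes_left_to_right_def by blast
  let ?ys = "map prod.swap xs"
  have "transpose_edge ` (consecutive xs)\<inverse> = (transpose_edge ` consecutive xs)\<inverse>"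
    by force
  then have "traverses ?ys (transpose_path P)"
    using xs(1)
    by (auto simp: traverses_def transpose_path_def consecutive_map distinct_map image_Un)
  moreover have "fst (hd ?ys) = 1" "fst (last ?ys) = n + 1"
    using xs by (auto simp: traverses_def hd_map last_map)
  moreover have "(\<forall>r c. sq r c \<and> u \<in> {(r, c), (r, c + 1)} \<longrightarrow> (u, v) = across r c) \<and>
      ((\<nexists>r c. sq r c \<and> u \<in> {(r, c), (r, c + 1)}) \<longrightarrow> v = (fst u + 1, snd u))"
    if "(u, v) \<in> consecutive ?ys" for u v
  proof -
    obtain i j i' j' where uv: "u = (i, j)" "v = (i', j')" by force
    have "((j, i), (j', i')) \<in> consecutive xs"
      using that by (simp add: consecutive_map mem_transpose_image uv)
    note step = steps[OF this]
    have eq: "(u, v) = transpose_edge e \<longleftrightarrow> ((j, i), (j', i')) = e" for e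
      by (cases e) (auto simp: uv)
    have mem: "u \<in> {(r, c), (r, c + 1)} \<longleftrightarrow> (j, i) \<in> {(c, r), (c + 1, r)}" for r c
      by (auto simp: uv)
    have "v = (fst u + 1, snd u) \<longleftrightarrow> (j', i') = (fst (j, i), snd (j, i) + 1)"
      by (auto simp: uv)
    with step show ?thesis unfolding sq across eq mem by blast
  qed
  ultimately show ?thesis unfolding goes_top_to_bottom_def by blast
qed

section \<open>Vertical paths through the inverse permutation\<close>

lemma signed_square_inverse_sp:
  assumes "\<pi> \<in> signed_perms n"
  shows "positive_square n (inverse_sp n \<pi>) c r \<longleftrightarrow> positive_square n \<pi> r c"
    and "negative_square n (inverse_sp n \<pi>) c r \<longleftrightarrow> negative_square n \<pi> r c"
proof -
  have *: "c \<in> {1..n} \<and> r = nat \<bar>inverse_sp n \<pi> c\<bar> \<longleftrightarrow> r \<in> {1..n} \<and> c = nat \<bar>\<pi> r\<bar>"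
    and sgn: "r \<in> {1..n} \<Longrightarrow> c = nat \<bar>\<pi> r\<bar> \<Longrightarrow> sgn (inverse_sp n \<pi> c) = sgn (\<pi> r)"
  proof -
    have inv: "nat \<bar>inverse_sp n \<pi> (nat \<bar>\<pi> i\<bar>)\<bar> = i" "nat \<bar>\<pi> i\<bar> \<in> {1..n}"
      "sgn (inverse_sp n \<pi> (nat \<bar>\<pi> i\<bar>)) = sgn (\<pi> i)" if "i \<in> {1..n}" for i
      using signed_perms_mem[OF assms that] inverse_sp_apply[OF assms that] that
      by (auto simp: abs_mult sgn_if)
    show "c \<in> {1..n} \<and> r = nat \<bar>inverse_sp n \<pi> c\<bar> \<longleftrightarrow> r \<in> {1..n} \<and> c = nat \<bar>\<pi> r\<bar>"
      \<comment> \<open>For the forward direction, surjectivity writes \<open>c\<close> as the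
        absolute value of an entry, whose row \<open>inv\<close> identifies with
        \<open>r\<close>.\<close>
      using inv signed_perms_abs_surj[OF assms] by metis
    show "r \<in> {1..n} \<Longrightarrow> c = nat \<bar>\<pi> r\<bar> \<Longrightarrow> sgn (inverse_sp n \<pi> c) = sgn (\<pi> r)"
      using inv(3) by blast
  qed
  show "positive_square n (inverse_sp n \<pi>) c r \<longleftrightarrow> positive_square n \<pi> r c"
    unfolding positive_square_def using * sgn by (metis sgn_greater)
  show "negative_square n (inverse_sp n \<pi>) c r \<longleftrightarrow> negative_square n \<pi> r c"
    unfolding negative_square_def using * sgn by (metis sgn_less)
qed

lemma dv_pos_transpose:
  assumes "\<pi> \<in> signed_perms n" "x \<in> grid_points n"
  shows "dv_pos n \<pi> x = dh_pos n (inverse_sp n \<pi>) (prod.swap x)"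
  using assms(2) inverse_sp_phi[OF assms(1)]
  by (auto simp: grid_points_def dv_pos_def dh_pos_def idesB_def)

lemma dv_neg_transpose:
  assumes "\<pi> \<in> signed_perms n" "x \<in> grid_points n"
  shows "dv_neg n \<pi> x = dh_neg n (inverse_sp n \<pi>) (prod.swap x)"
  using assms(2) inverse_sp_phi_bar[OF assms(1)]
  by (auto simp: grid_points_def dv_neg_def dh_neg_def idesB_def)

lemma filled_square_inverse_sp:
  assumes "\<pi> \<in> signed_perms n"
  shows "filled_square n \<pi> r c \<longleftrightarrow> filled_square n (inverse_sp n \<pi>) c r"
  by (simp add: filled_square_def signed_square_inverse_sp[OF assms])

text \<open>The reflection of \<open>crossing\<close>: southeast is preserved and northeast becomes
  southwest.\<close>

definition v_crossing :: "int \<Rightarrow> nat \<Rightarrow> nat \<Rightarrow> point \<times> point" where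
  "v_crossing p = (if p = 0 then southeast else southwest)"

lemma v_crossing_transpose: "v_crossing p r c = transpose_edge (crossing p c r)"
  by (simp add: v_crossing_def crossing_def southeast_def southwest_def northeast_def)

lemma v_paths_dv_pos:
  assumes "\<pi> \<in> signed_perms n" "p \<in> {0, 1}" "P \<in> v_paths n \<pi> (dv_pos n \<pi>) p"
  shows "goes_top_to_bottom n (positive_square n \<pi>) (v_crossing p) P"
proof -
  let ?\<sigma> = "inverse_sp n \<pi>"
  obtain Q where Q: "Q \<in> h_paths n ?\<sigma> (dh_pos n ?\<sigma>) p" "P = transpose_path Q"
    using assms(3) v_paths_transpose[where d = "dv_pos n \<pi>" and d' = "dh_pos n ?\<sigma>",
        OF filled_square_inverse_sp[OF assms(1)] dv_pos_transpose[OF assms(1)]]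
    by blast
  show ?thesis
    using goes_top_to_bottom_transpose[OF
        h_paths_dh_pos[OF inverse_sp_signed_perms[OF assms(1)] assms(2) Q(1)]
        signed_square_inverse_sp(1)[OF assms(1), symmetric] v_crossing_transpose]
    by (simp add: Q(2))
qed

lemma v_paths_dv_neg:
  assumes "\<pi> \<in> signed_perms n" "p \<in> {0, 1}" "P \<in> v_paths n \<pi> (dv_neg n \<pi>) p"
  shows "goes_top_to_bottom n (negative_square n \<pi>) (v_crossing (1 - p)) P"
proof -
  let ?\<sigma> = "inverse_sp n \<pi>"
  obtain Q where Q: "Q \<in> h_paths n ?\<sigma> (dh_neg n ?\<sigma>) p" "P = transpose_path Q"
    using assms(3) v_paths_transpose[where d = "dv_neg n \<pi>" and d' = "dh_neg n ?\<sigma>",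
        OF filled_square_inverse_sp[OF assms(1)] dv_neg_transpose[OF assms(1)]]
    by blast
  show ?thesis
    using goes_top_to_bottom_transpose[OF
        h_paths_dh_neg[OF inverse_sp_signed_perms[OF assms(1)] assms(2) Q(1)]
        signed_square_inverse_sp(2)[OF assms(1), symmetric] v_crossing_transpose]
    by (simp add: Q(2))
qed

theorem theorem3p12:
  fixes n :: nat and \<pi> :: "nat \<Rightarrow> int"
  assumes "\<pi> \<in> signed_perms n"
  shows
    "(\<forall>P \<in> h_paths n \<pi> (dh_pos n \<pi>) 0. goes_left_to_right n (positive_square n \<pi>) southeast P) \<and>
     (\<forall>P \<in> h_paths n \<pi> (dh_pos n \<pi>) 1. goes_left_to_right n (positive_square n \<pi>) northeast P) \<and>
     (\<forall>P \<in> v_paths n \<pi> (dv_pos n \<pi>) 0. goes_top_to_bottom n (positive_square n \<pi>) southeast P) \<and>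
     (\<forall>P \<in> v_paths n \<pi> (dv_pos n \<pi>) 1. goes_top_to_bottom n (positive_square n \<pi>) southwest P) \<and>
     (\<forall>P \<in> h_paths n \<pi> (dh_neg n \<pi>) 0. goes_left_to_right n (negative_square n \<pi>) northeast P) \<and>
     (\<forall>P \<in> h_paths n \<pi> (dh_neg n \<pi>) 1. goes_left_to_right n (negative_square n \<pi>) southeast P) \<and>
     (\<forall>P \<in> v_paths n \<pi> (dv_neg n \<pi>) 0. goes_top_to_bottom n (negative_square n \<pi>) southwest P) \<and>
     (\<forall>P \<in> v_paths n \<pi> (dv_neg n \<pi>) 1. goes_top_to_bottom n (negative_square n \<pi>) southeast P)"
  \<comment> \<open>The negative cases carry \<open>1 - p\<close>, so their directions for types 0
    and 1 are interchanged.\<close>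
  using h_paths_dh_pos[OF assms, of 0] h_paths_dh_pos[OF assms, of 1]
    v_paths_dv_pos[OF assms, of 0] v_paths_dv_pos[OF assms, of 1]
    h_paths_dh_neg[OF assms, of 0] h_paths_dh_neg[OF assms, of 1]
    v_paths_dv_neg[OF assms, of 0] v_paths_dv_neg[OF assms, of 1]
  by (simp add: crossing_def v_crossing_def)

end
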